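(* Let $v$ be a weighted game on $n$ voters and $v^*$ its dual game. Then the interior of $P_v$ is the image of the interior of $P_{v^*}$ under the reflection $(q:\mathbf w)\mapsto(1-q:\mathbf w)$ about the hyperplane $q=1/2$.
   Context: Let $N=\{1,\dots,n\}$. A simple game is a family $W$ of subsets of $N$ (winning coalitions) with $N\in W$, $\emptyset\notin W$, closed under supersets. The dual game $v^*$ of $v$ has winning coalitions exactly those $A$ such that $N\setminus A$ is losing in $v$. A weighted game on $n$ voters is a simple game $v$ with winning set $W_v$ for which there exists $(q:\mathbf{w})$ with $\mathbf w=(w_n,\dots,w_1)\in\Delta_n:=\{w_n\ge\dots\ge w_1\ge0,\ \sum_i w_i=1\}$ and $q\in(0,1]$ such that $A\in W_v$ iff $w_A:=\sum_{i\in A}w_i\ge q$ (a realization of $v$). $P_v\subseteq(0,1]\times\Delta_n$ denotes the set of realizations of $v$. Interiors are taken relative to the $n$-dimensional affine space $\mathbb R\times\{\mathbf w:\sum_i w_i=1\}$. *)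

theory Defs
  imports "HOL-Analysis.Analysis"
begin

(* The voter set N = {1,...,n} is the universe of a finite linearly ordered type 'n, with
   n = CARD('n): the order of 'n is the numbering of the voters, and it is used only to say
   that weights are listed monotonically.  A game is identified with its family of winning
   coalitions, a term of type 'n set set. *)

definition simple_game :: "'n::finite set set \<Rightarrow> bool" where
  "simple_game W \<longleftrightarrow>
     UNIV \<in> W \<and> {} \<notin> W \<and> (\<forall>A B. A \<in> W \<and> A \<subseteq> B \<longrightarrow> B \<in> W)"

definition dual_game :: "'n::finite set set \<Rightarrow> 'n set set" where
  "dual_game W = {A. UNIV - A \<notin> W}"

lemma simple_game_dual_game: "simple_game W \<Longrightarrow> simple_game (dual_game W)"
  unfolding simple_game_def dual_game_def
  by (simp, metis Compl_anti_mono Compl_eq_Diff_UNIV)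

definition coalition_weight :: "real ^ 'n \<Rightarrow> 'n::finite set \<Rightarrow> real" where
  "coalition_weight w A = (\<Sum>i\<in>A. w $ i)"

definition weight_simplex :: "(real ^ 'n::{finite,linorder}) set" where
  "weight_simplex =
     {w. (\<forall>i j. i \<le> j \<longrightarrow> w $ i \<le> w $ j) \<and> (\<forall>i. 0 \<le> w $ i) \<and> (\<Sum>i\<in>UNIV. w $ i) = 1}"

definition realizations ::
  "'n::{finite,linorder} set set
    \<Rightarrow> (real \<times> (real ^ 'n::{finite,linorder})) set" where
  "realizations W =
     {(q, w). q \<in> {0<..1} \<and> w \<in> weight_simplex \<and>
        (\<forall>A. A \<in> W \<longleftrightarrow> coalition_weight w A \<ge> q)}"

definition weighted_game :: "'n::{finite,linorder} set set \<Rightarrow> bool" where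
  "weighted_game W \<longleftrightarrow> simple_game W \<and> realizations W \<noteq> {}"

definition realization_space :: "(real \<times> (real ^ 'n::finite)) set" where
  "realization_space = UNIV \<times> {w. (\<Sum>i\<in>UNIV. w $ i) = 1}"

(* The interior is taken in the fixed affine space above.  It is not rel_interior, which
   refers to the affine hull of the set itself and so differs for lower-dimensional sets. *)

definition game_interior :: "(real \<times> (real ^ 'n::finite)) set \<Rightarrow> (real \<times> (real ^ 'n)) set" where
  "game_interior S = (top_of_set realization_space) interior_of S"

definition quota_reflection :: "real \<times> (real ^ 'n::finite) \<Rightarrow> real \<times> (real ^ 'n)" where
  "quota_reflection = (\<lambda>(q, w). (1 - q, w))"

end

(* At an interior point (q : w) the quota can be raised slightly without changing the game, so no
   coalition has weight exactly q.  Hence A wins the dual game iff 1 - w_A < q iff w_A \<ge> 1 - q, and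
   the reflection maps the interior of P_v into P_{v*}.  Its image is relatively open, so it lies in
   the interior; the reverse inclusion follows because duality and reflection are involutions. *)

theory Submission
  imports Defs
begin

lemma dual_game_dual_game [simp]: "dual_game (dual_game W) = W"
  by (auto simp: dual_game_def double_diff)

lemma quota_reflection_quota_reflection [simp]: "quota_reflection (quota_reflection x) = x"
  by (cases x) (simp add: quota_reflection_def)

text \<open>Holds because the reflection is an involution. Preimages are what continuity and
  pointwise arguments handle directly.\<close>

lemma quota_reflection_image_eq_vimage: "quota_reflection ` S = quota_reflection -` S"
proof
  show "quota_reflection -` S \<subseteq> quota_reflection ` S"
    by (metis imageI quota_reflection_quota_reflection subsetI vimageE)
qed auto

text \<open>The reflection is continuous and changes only the quota, so it preserves the affine
  space; being its own inverse, it sends relatively open sets to relatively open sets.\<close>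

lemma openin_quota_reflection_image:
  assumes "openin (top_of_set realization_space) S"
  shows "openin (top_of_set realization_space) (quota_reflection ` S)"
proof -
  obtain U where U: "open U" "S = realization_space \<inter> U"
    using assms by (auto simp: openin_open)
  have "open (quota_reflection -` U)"
    using U(1) unfolding quota_reflection_def case_prod_unfold
    by (intro open_vimage continuous_intros)
  moreover have "quota_reflection ` S = realization_space \<inter> quota_reflection -` U"
    unfolding quota_reflection_image_eq_vimage U(2)
    by (auto simp: quota_reflection_def realization_space_def)
  ultimately show ?thesis
    by (auto simp: openin_open)
qed

text \<open>The affine space leaves the quota coordinate free, so a small ball around an interior
  point allows a move straight up without leaving the space.\<close>

lemma game_interior_raise_quota:
  assumes "(q, w) \<in> game_interior S"
  obtains e where "e > 0" "(q + e, w) \<in> S"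
proof -
  obtain T where "openin (top_of_set realization_space) T" "(q, w) \<in> T" "T \<subseteq> S"
    using assms by (auto simp: game_interior_def interior_of_def)
  then obtain U where U: "open U" "T = realization_space \<inter> U" and qw: "(q, w) \<in> T"
    by (auto simp: openin_open)
  obtain d where d: "d > 0" "ball (q, w) d \<subseteq> U"
    using U qw by (meson IntE open_contains_ball)
  have "(q + d / 2, w) \<in> ball (q, w) d"
    using d(1) by (simp add: dist_Pair_Pair dist_real_def)
  then have "(q + d / 2, w) \<in> T"
    using d(2) U(2) qw by (auto simp: realization_space_def)
  then show thesis
    using that[of "d / 2"] d(1) \<open>T \<subseteq> S\<close> by auto
qed

lemma coalition_weight_Compl:
  assumes "w \<in> weight_simplex"
  shows "coalition_weight w (UNIV - A) = 1 - coalition_weight w A"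
  using assms sum_diff[of UNIV A "\<lambda>i. w $ i"]
  by (simp add: coalition_weight_def weight_simplex_def)

lemma quota_reflection_in_realizations_dual_game:
  assumes "x \<in> game_interior (realizations W)"
  shows "quota_reflection x \<in> realizations (dual_game W)"
proof -
  obtain q w where x: "x = (q, w)"
    by (cases x)
  have "game_interior (realizations W) \<subseteq> realizations W"
    by (simp add: game_interior_def interior_of_subset)
  then have qw: "(q, w) \<in> realizations W"
    using assms x by auto
  obtain e where e: "e > 0" "(q + e, w) \<in> realizations W"
    using assms x game_interior_raise_quota by metis
  \<comment> \<open>With quota \<open>q + e\<close> also realizing \<open>W\<close>, every winning
    coalition weighs at least \<open>q + e\<close>, hence more than \<open>q\<close>.\<close>
  have no_tie: "A \<in> W \<longleftrightarrow> coalition_weight w A > q" for A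
    using qw e unfolding realizations_def by fastforce
  have w: "w \<in> weight_simplex"
    using qw by (simp add: realizations_def)
  have "A \<in> dual_game W \<longleftrightarrow> coalition_weight w A \<ge> 1 - q" for A
    unfolding dual_game_def mem_Collect_eq no_tie coalition_weight_Compl[OF w] by auto
  \<comment> \<open>The new quota satisfies \<open>1 - q > 0\<close> because
    \<open>q + e \<le> 1\<close> with \<open>e > 0\<close>, and \<open>1 - q \<le> 1\<close> because
    \<open>q > 0\<close>.\<close>
  then show ?thesis
    using qw e by (auto simp: x realizations_def quota_reflection_def)
qed

text \<open>Stated for an arbitrary \<open>W\<close> so that it can be applied both to a game and to
  its dual.\<close>

lemma quota_reflection_game_interior_subset:
  "quota_reflection ` game_interior (realizations W) \<subseteq> game_interior (realizations (dual_game W))"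
proof -
  have "openin (top_of_set realization_space) (quota_reflection ` game_interior (realizations W))"
    by (intro openin_quota_reflection_image) (simp add: game_interior_def)
  moreover have "quota_reflection ` game_interior (realizations W) \<subseteq> realizations (dual_game W)"
    using quota_reflection_in_realizations_dual_game by blast
  ultimately show ?thesis
    unfolding game_interior_def[of "realizations (dual_game W)"] by (rule interior_of_maximal[rotated])
qed

theorem theorem4p4:
  fixes v :: "'n::{finite,linorder} set set"
  assumes "weighted_game v"
  shows "game_interior (realizations v) =
         quota_reflection ` game_interior (realizations (dual_game v))"
proof
  show "quota_reflection ` game_interior (realizations (dual_game v)) \<subseteq> game_interior (realizations v)"
    using quota_reflection_game_interior_subset[of "dual_game v"] by simp
  show "game_interior (realizations v) \<subseteq> quota_reflection ` game_interior (realizations (dual_game v))"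
    \<comment> \<open>With the image read as a preimage, this inclusion is the lemma for
      \<open>v\<close> itself.\<close>
    using quota_reflection_game_interior_subset[of v]
    unfolding quota_reflection_image_eq_vimage[of "game_interior (realizations (dual_game v))"] by blast
qed

end
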